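(* The bi-confluent Heun equation $$u''(x)+\left(\frac{1+\alpha}{x}+\frac{\sqrt2\,t}{2}-x\right)u'(x)+\frac{\sqrt6\,n^{3/2}}{9x}\,u(x)=0$$ can be transformed (by the method of isomonodromic deformations with respect to $t$) into a Painlevé IV equation.
   Context: Here $n$ is a positive integer (the degree of an orthogonal polynomial), and $\alpha>0$, $t>0$ are parameters. The equation arises from polynomials orthogonal with respect to a deformed Freud weight on $\mathbb R$ (a power of $|x|$ times $\exp(-x^4+tx^2)$). "Transformed" refers to the following method of isomonodromic deformations. Write the equation as $\sigma u''+\tau u'+\eta u=0$ with $\sigma,\tau,\eta$ polynomials in $x$ that may depend on $t$. Introduce additional parameters $\lambda,\mu$ with $\sigma(\lambda)\ne0$, and the deformed equation $$\sigma(x)\varphi''+\left(\tau(x)-\frac{\sigma(x)}{x-\lambda}\right)\varphi'+\left(\eta(x)-\eta(\lambda)-\mu\big(\tau(\lambda)-\sigma'(\lambda)\big)-\mu^2\sigma(\lambda)+\frac{\mu\,\sigma(\lambda)}{x-\lambda}\right)\varphi=0,$$ which has an additional non-logarithmic singularity at $x=\lambda$. Let $\lambda,\mu$ depend on $t$ and require the deformed equation to be compatible with an equation $\partial_t\varphi=a(x,t)\,\partial_x\varphi+b(x,t)\,\varphi$ for suitable compatibility functions $a,b$. This compatibility is expressed by a Hamiltonian system $\dot\lambda=\partial H/\partial\mu$, $\dot\mu=-\partial H/\partial\lambda$. Eliminating $\mu$ gives a second order equation for $\lambda$, which is to be a Painlevé equation, possibly after a change of variables. The Painlevé IV equation with parameters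 $(A,B)$ is $$\frac{d^2y}{dz^2}=\frac1{2y}\left(\frac{dy}{dz}\right)^2+\frac32y^3+4zy^2+2(z^2-A)y+\frac{B}{y}.$$ *)

theory Defs
  imports "HOL-Analysis.Analysis" "HOL-Computational_Algebra.Polynomial"
begin

section \<open>The deformed equation\<close>

text \<open>
  An equation \<open>\<sigma> u'' + \<tau> u' + \<eta> u = 0\<close> is given by polynomials \<open>\<sigma> t\<close>, \<open>\<tau> t\<close>, \<open>\<eta> t\<close> in the complex
  variable \<open>x\<close> that may depend on the real deformation parameter \<open>t > 0\<close>. The additional parameters
  are \<open>l\<close> (position of the additional singularity) and \<open>m\<close>. Divided by \<open>\<sigma>\<close>, the deformed equation
  is \<open>\<phi>'' + P \<phi>' + Q \<phi> = 0\<close>, with \<open>P\<close>, \<open>Q\<close> given by the following two functions.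
\<close>

definition deformed_P :: "complex poly \<Rightarrow> complex poly \<Rightarrow> complex \<Rightarrow> complex \<Rightarrow> complex" where
  "deformed_P \<sigma> \<tau> l x = (poly \<tau> x - poly \<sigma> x / (x - l)) / poly \<sigma> x"

definition deformed_Q ::
  "complex poly \<Rightarrow> complex poly \<Rightarrow> complex poly \<Rightarrow> complex \<Rightarrow> complex \<Rightarrow> complex \<Rightarrow> complex" where
  "deformed_Q \<sigma> \<tau> \<eta> l m x =
     (poly \<eta> x - poly \<eta> l - m * (poly \<tau> l - poly (pderiv \<sigma>) l) - m\<^sup>2 * poly \<sigma> l
        + m * poly \<sigma> l / (x - l)) / poly \<sigma> x"


section \<open>Compatibility of two linear equations\<close>

text \<open>
  We consider the system \<open>\<phi>_xx = - P \<phi>_x - Q \<phi>\<close>, \<open>\<phi>_t = a \<phi>_x + b \<phi>\<close> with coefficients depending on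
  \<open>(x,t)\<close>. By the first equation every expression in \<open>\<phi>\<close> and its derivatives can be reduced to
  the form \<open>f \<phi> + g \<phi>_x\<close>, which is represented by the pair \<open>(f, g)\<close>. The functions \<open>total_dx\<close>
  and \<open>total_dt\<close> are the derivatives of such an expression, again reduced to this form. In
  \<open>total_dt\<close> the mixed derivative \<open>\<phi>_tx\<close> is the \<open>x\<close>-derivative \<open>h \<phi> + k \<phi>_x\<close> of \<open>b \<phi> + a \<phi>_x\<close>.
\<close>

type_synonym coeff = "complex \<Rightarrow> real \<Rightarrow> complex"

definition pd_x :: "coeff \<Rightarrow> coeff" where
  "pd_x f = (\<lambda>x t. deriv (\<lambda>y. f y t) x)"

definition pd_t :: "coeff \<Rightarrow> coeff" where
  "pd_t f = (\<lambda>x t. vector_derivative (\<lambda>s. f x s) (at t))"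

definition total_dx :: "coeff \<Rightarrow> coeff \<Rightarrow> coeff \<times> coeff \<Rightarrow> coeff \<times> coeff" where
  "total_dx P Q w = (case w of (f, g) \<Rightarrow>
     (\<lambda>x t. pd_x f x t - g x t * Q x t,
      \<lambda>x t. f x t + pd_x g x t - g x t * P x t))"

definition total_dt :: "coeff \<Rightarrow> coeff \<Rightarrow> coeff \<Rightarrow> coeff \<Rightarrow> coeff \<times> coeff \<Rightarrow> coeff \<times> coeff" where
  "total_dt P Q a b w = (case w of (f, g) \<Rightarrow> case total_dx P Q (b, a) of (h, k) \<Rightarrow>
     (\<lambda>x t. pd_t f x t + f x t * b x t + g x t * h x t,
      \<lambda>x t. pd_t g x t + f x t * a x t + g x t * k x t))"

text \<open>
  The two equations are compatible on \<open>{(x,t). t \<in> T \<and> x \<in> X t}\<close> if \<open>(\<phi>_t)_xx = (\<phi>_xx)_t\<close> holds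
  identically there, i.e. for all values of \<open>\<phi>\<close> and \<open>\<phi>_x\<close>.
\<close>

definition compatible ::
  "real set \<Rightarrow> (real \<Rightarrow> complex set) \<Rightarrow> coeff \<Rightarrow> coeff \<Rightarrow> coeff \<Rightarrow> coeff \<Rightarrow> bool" where
  "compatible T X P Q a b \<longleftrightarrow>
     (\<forall>t\<in>T. \<forall>f\<in>{P, Q, a, b}. (\<lambda>x. f x t) holomorphic_on X t) \<and>
     (\<forall>t\<in>T. \<forall>x\<in>X t. (\<lambda>s. P x s) differentiable (at t) \<and> (\<lambda>s. Q x s) differentiable (at t)) \<and>
     (\<forall>t\<in>T. \<forall>x\<in>X t.
        let (f, g) = total_dx P Q (total_dx P Q (b, a));
            (f', g') = total_dt P Q a b (\<lambda>x t. - Q x t, \<lambda>x t. - P x t)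
        in f x t = f' x t \<and> g x t = g' x t)"


section \<open>Hamiltonian systems and Painlev\'e IV\<close>

text \<open>The arguments of a Hamiltonian are \<open>\<lambda>\<close>, \<open>\<mu>\<close> and \<open>t\<close>, in this order.\<close>

definition hamiltonian_system ::
  "(complex \<Rightarrow> complex \<Rightarrow> real \<Rightarrow> complex) \<Rightarrow> real set \<Rightarrow> (real \<Rightarrow> complex) \<Rightarrow> (real \<Rightarrow> complex) \<Rightarrow> bool"
where
  "hamiltonian_system H T lam \<mu> \<longleftrightarrow> (\<forall>t\<in>T.
     (lam has_vector_derivative deriv (\<lambda>m. H (lam t) m t) (\<mu> t)) (at t) \<and>
     (\<mu> has_vector_derivative - deriv (\<lambda>l. H l (\<mu> t) t) (lam t)) (at t))"

definition painleve_IV ::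
  "complex \<Rightarrow> complex \<Rightarrow> real set \<Rightarrow> (real \<Rightarrow> complex) \<Rightarrow> bool" where
  "painleve_IV A B Z y \<longleftrightarrow> (\<exists>y' y''. \<forall>z\<in>Z.
     y z \<noteq> 0 \<and>
     (y has_vector_derivative y' z) (at z) \<and>
     (y' has_vector_derivative y'' z) (at z) \<and>
     y'' z = 1 / (2 * y z) * (y' z)\<^sup>2 + 3 / 2 * (y z) ^ 3 + 4 * of_real z * (y z)\<^sup>2
             + 2 * ((of_real z)\<^sup>2 - A) * y z + B / y z)"


section \<open>The method of isomonodromic deformations\<close>

text \<open>
  The compatibility functions \<open>a l m t x\<close> and \<open>b l m t x\<close> depend on \<open>t\<close> also through \<open>l = \<lambda>(t)\<close> and
  \<open>m = \<mu>(t)\<close>. For a deformation to be isomonodromic they have to be single-valued in \<open>x\<close>; we require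
  that they are rational, without poles outside the singular points of the deformed equation.
\<close>

definition rational_off :: "complex poly \<Rightarrow> complex \<Rightarrow> (complex \<Rightarrow> complex) \<Rightarrow> bool" where
  "rational_off \<sigma> l f \<longleftrightarrow> (\<exists>p q. \<forall>x. poly \<sigma> x \<noteq> 0 \<longrightarrow> x \<noteq> l \<longrightarrow>
     poly q x \<noteq> 0 \<and> f x = poly p x / poly q x)"

definition admissible :: "(real \<Rightarrow> complex poly) \<Rightarrow> real set \<Rightarrow> (real \<Rightarrow> complex) \<Rightarrow> bool" where
  "admissible \<sigma> T lam \<longleftrightarrow> open T \<and> T \<subseteq> {0<..} \<and> (\<forall>t\<in>T. poly (\<sigma> t) (lam t) \<noteq> 0)"

definition isomonodromic_hamiltonian ::
  "(real \<Rightarrow> complex poly) \<Rightarrow> (real \<Rightarrow> complex poly) \<Rightarrow> (real \<Rightarrow> complex poly) \<Rightarrow>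
   (complex \<Rightarrow> complex \<Rightarrow> real \<Rightarrow> complex) \<Rightarrow> bool" where
  "isomonodromic_hamiltonian \<sigma> \<tau> \<eta> H \<longleftrightarrow>
     (\<forall>t>0. \<forall>l m. poly (\<sigma> t) l \<noteq> 0 \<longrightarrow>
        (\<lambda>l. H l m t) field_differentiable (at l) \<and> (\<lambda>m. H l m t) field_differentiable (at m)) \<and>
     (\<exists>a b :: complex \<Rightarrow> complex \<Rightarrow> real \<Rightarrow> complex \<Rightarrow> complex.
        (\<forall>t>0. \<forall>l m. poly (\<sigma> t) l \<noteq> 0 \<longrightarrow>
           rational_off (\<sigma> t) l (a l m t) \<and> rational_off (\<sigma> t) l (b l m t)) \<and>
        (\<forall>T lam \<mu>. admissible \<sigma> T lam \<longrightarrow>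
           (\<forall>t\<in>T. lam differentiable (at t) \<and> \<mu> differentiable (at t)) \<longrightarrow>
           (compatible T (\<lambda>t. {x. poly (\<sigma> t) x \<noteq> 0 \<and> x \<noteq> lam t})
              (\<lambda>x t. deformed_P (\<sigma> t) (\<tau> t) (lam t) x)
              (\<lambda>x t. deformed_Q (\<sigma> t) (\<tau> t) (\<eta> t) (lam t) (\<mu> t) x)
              (\<lambda>x t. a (lam t) (\<mu> t) t x)
              (\<lambda>x t. b (lam t) (\<mu> t) t x)
            \<longleftrightarrow> hamiltonian_system H T lam \<mu>)))"

text \<open>
  Elimination of \<open>\<mu>\<close> means that \<open>\<lambda>\<close> can be completed by some \<open>\<mu>\<close> to a solution of the Hamiltonian
  system iff it solves the resulting equation. The change of variables is a scaling:
  \<open>y(z) = \<rho> \<lambda>(t)\<close>, \<open>z = \<kappa> t\<close>.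
\<close>

definition transforms_to_painleve_IV ::
  "(real \<Rightarrow> complex poly) \<Rightarrow> (real \<Rightarrow> complex poly) \<Rightarrow> (real \<Rightarrow> complex poly) \<Rightarrow> bool" where
  "transforms_to_painleve_IV \<sigma> \<tau> \<eta> \<longleftrightarrow>
     (\<exists>H. isomonodromic_hamiltonian \<sigma> \<tau> \<eta> H \<and>
        (\<exists>A B \<rho> \<kappa>. \<rho> \<noteq> 0 \<and> \<kappa> \<noteq> 0 \<and>
           (\<forall>T lam. admissible \<sigma> T lam \<longrightarrow>
              ((\<exists>\<mu>. hamiltonian_system H T lam \<mu>) \<longleftrightarrow>
               painleve_IV A B ((\<lambda>t. \<kappa> * t) ` T) (\<lambda>z. \<rho> * lam (z / \<kappa>))))))"


section \<open>The bi-confluent Heun equation\<close>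

definition biconfluent_heun :: "real \<Rightarrow> nat \<Rightarrow> real \<Rightarrow> (complex \<Rightarrow> complex) \<Rightarrow> complex \<Rightarrow> bool" where
  "biconfluent_heun \<alpha> n t u x \<longleftrightarrow>
     deriv (deriv u) x
     + ((1 + of_real \<alpha>) / x + of_real (sqrt 2 * t / 2) - x) * deriv u x
     + of_real (sqrt 6 * real n powr (3 / 2)) / (9 * x) * u x = 0"

definition heun_sigma :: "real \<Rightarrow> complex poly" where
  "heun_sigma t = [:0, 1:]"

definition heun_tau :: "real \<Rightarrow> real \<Rightarrow> complex poly" where
  "heun_tau \<alpha> t = [:1 + of_real \<alpha>, of_real (sqrt 2 * t / 2), - 1:]"

definition heun_eta :: "nat \<Rightarrow> real \<Rightarrow> complex poly" where
  "heun_eta n t = [:of_real (sqrt 6 * real n powr (3 / 2) / 9):]"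

end

theory Submission
  imports Defs
begin

text \<open>
  Put \<open>r = 1 / \<surd>2\<close>, so that the linear coefficient of \<open>\<tau>\<close> is \<open>s = r t\<close>, and
  \<open>q = \<tau>(\<lambda>) - \<sigma>'(\<lambda>) = \<alpha> + s \<lambda> - \<lambda>\<^sup>2\<close>. Since \<open>\<eta>\<close> is constant, it cancels from the deformed
  equation; this is why \<open>n\<close> leaves no trace in the Painlev\'e equation.

  Writing \<open>\<phi>_t = a \<phi>_x + b \<phi>\<close>, equality of \<open>(\<phi>_t)_xx\<close> and \<open>(\<phi>_xx)_t\<close> amounts to
  \<open>a_xx + 2 b_x - (a P)_x + P_t = 0\<close> and \<open>b_xx + P b_x - 2 a_x Q - a Q_x + Q_t = 0\<close>
  (\<open>total_derivatives_agree_iff\<close>). Boundedness of \<open>a\<close> and \<open>b\<close> at infinity, a simple pole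
  of \<open>a\<close> at \<open>\<lambda>\<close> and a zero of \<open>a\<close> at the fixed singularity \<open>0\<close> suggest \<open>a = - r x / (x - \<lambda>)\<close>;
  the poles of third order at \<open>\<lambda>\<close> then cancel for \<open>b = r \<lambda> \<mu> / (x - \<lambda>)\<close>. What remains of the
  first equation is \<open>- r (2 \<lambda> \<mu> + q) - \<lambda>'\<close> over \<open>(x - \<lambda>)\<^sup>2\<close> (\<open>residual_of_phi_x\<close>). Once that
  vanishes, what remains of the second is \<open>\<mu>' - r (\<mu>\<^sup>2 + (s - 2 \<lambda>) \<mu>)\<close> times a rational function of
  \<open>x\<close> which is not identically zero (\<open>residual_of_phi\<close>). Both vanish exactly along the flow of
  \<open>H = - r (\<lambda> \<mu>\<^sup>2 + q \<mu>)\<close>; this is \<open>heun_hamiltonian_isomonodromic\<close>.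

  With \<open>v = 2 \<lambda> \<mu> + q\<close> the first Hamilton equation reads \<open>\<lambda>' = - r v\<close>. As \<open>\<lambda> \<noteq> 0\<close>, it determines
  \<open>\<mu>\<close>, and the second one becomes
  \<open>\<lambda>_ss = \<lambda>_s\<^sup>2 / (2 \<lambda>) + 3/2 \<lambda>\<^sup>3 - 2 s \<lambda>\<^sup>2 + (s\<^sup>2/2 - \<alpha> - 1) \<lambda> - \<alpha>\<^sup>2 / (2 \<lambda>)\<close>.
  Comparing coefficients with Painlev\'e IV leads to the scaling \<open>z = t / 2\<close>, \<open>y = - \<surd>2 \<lambda>\<close> and the
  parameters \<open>A = \<alpha> + 1\<close>, \<open>B = - 2 \<alpha>\<^sup>2\<close>. In these variables
  \<open>dy/dz = 2 v\<close>, so that the elimination can be carried out in either direction with \<open>v\<close> in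
  place of the derivative.
\<close>


section \<open>Compatibility as two scalar equations\<close>

text \<open>
  Expanding both derivatives, the terms \<open>a P\<^sup>2\<close>, \<open>a Q\<close>, \<open>b P\<close> and one copy of \<open>a_x P\<close> of the \<open>\<phi>_x\<close> component,
  and \<open>b Q\<close> and \<open>a P Q\<close> of the \<open>\<phi>\<close> component, cancel against each other. The neighbourhood \<open>X\<close> is there because \<open>a\<close> and \<open>b\<close> are differentiated twice in \<open>x\<close>.
\<close>

lemma total_derivatives_agree_iff:
  assumes X: "open X" "x \<in> X"
    and a: "\<And>y. y \<in> X \<Longrightarrow> ((\<lambda>y. a y t) has_field_derivative a1 y) (at y)"
           "(a1 has_field_derivative a2) (at x)"
    and b: "\<And>y. y \<in> X \<Longrightarrow> ((\<lambda>y. b y t) has_field_derivative b1 y) (at y)"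
           "(b1 has_field_derivative b2) (at x)"
    and P: "((\<lambda>y. P y t) has_field_derivative P1) (at x)" "((\<lambda>s. P x s) has_vector_derivative P_t) (at t)"
    and Q: "((\<lambda>y. Q y t) has_field_derivative Q1) (at x)" "((\<lambda>s. Q x s) has_vector_derivative Q_t) (at t)"
  shows "(let (f, g) = total_dx P Q (total_dx P Q (b, a));
              (f', g') = total_dt P Q a b (\<lambda>x t. - Q x t, \<lambda>x t. - P x t)
          in f x t = f' x t \<and> g x t = g' x t) \<longleftrightarrow>
         a2 + 2 * b1 x - a1 x * P x t - a x t * P1 + P_t = 0 \<and>
         b2 + P x t * b1 x - 2 * a1 x * Q x t - a x t * Q1 + Q_t = 0"
proof -
  have da: "deriv (\<lambda>y. a y t) y = a1 y" and db: "deriv (\<lambda>y. b y t) y = b1 y" if "y \<in> X" for y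
    using a(1) b(1) that by (auto intro: DERIV_imp_deriv)
  have "((\<lambda>y. b1 y - a y t * Q y t) has_field_derivative
           b2 - (a1 x * Q x t + a x t * Q1)) (at x)"
    by (auto intro!: derivative_eq_intros a b P Q X)
  then have "((\<lambda>y. deriv (\<lambda>y. b y t) y - a y t * Q y t) has_field_derivative
           b2 - (a1 x * Q x t + a x t * Q1)) (at x)"
    by (rule has_field_derivative_transform_within_open[OF _ X]) (simp add: db)
  then have h: "deriv (\<lambda>y. deriv (\<lambda>y. b y t) y - a y t * Q y t) x = b2 - (a1 x * Q x t + a x t * Q1)"
    by (rule DERIV_imp_deriv)
  have "((\<lambda>y. b y t + a1 y - a y t * P y t) has_field_derivative
           b1 x + a2 - (a1 x * P x t + a x t * P1)) (at x)"
    by (auto intro!: derivative_eq_intros a b P Q X)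
  then have "((\<lambda>y. b y t + deriv (\<lambda>y. a y t) y - a y t * P y t) has_field_derivative
           b1 x + a2 - (a1 x * P x t + a x t * P1)) (at x)"
    by (rule has_field_derivative_transform_within_open[OF _ X]) (simp add: da)
  then have k: "deriv (\<lambda>y. b y t + deriv (\<lambda>y. a y t) y - a y t * P y t) x
      = b1 x + a2 - (a1 x * P x t + a x t * P1)"
    by (rule DERIV_imp_deriv)
  have Pt: "vector_derivative (\<lambda>s. - P x s) (at t) = - P_t"
    and Qt: "vector_derivative (\<lambda>s. - Q x s) (at t) = - Q_t"
    using P(2) Q(2) by (auto intro!: vector_derivative_at has_vector_derivative_minus)
  show ?thesis
    unfolding total_dx_def total_dt_def pd_x_def pd_t_def
    by (simp add: Let_def h k Pt Qt da[OF X(2)] db[OF X(2)]) (auto simp: algebra_simps)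
qed

text \<open>
  The next two identities evaluate the scalar equations for the chosen \<open>a\<close> and \<open>b\<close>, with all derivatives
  already inserted. In the first, \<open>l'\<close> is the unknown velocity of \<open>\<lambda>\<close>. It is the coefficient of \<open>\<phi>_x\<close>
  that determines \<open>l'\<close>, because \<open>\<lambda>\<close> is the only pole of \<open>P\<close> that moves.
\<close>

lemma residual_of_phi_x:
  fixes x l m r s \<alpha> l' :: complex
  assumes "x \<noteq> 0" "x \<noteq> l"
  shows "- (2 * (r * l)) / (x - l) ^ 3 + 2 * (- (r * l * m) / (x - l)\<^sup>2)
         - r * l / (x - l)\<^sup>2 * ((1 + \<alpha>) / x + s - x - 1 / (x - l))
         - - (r * x) / (x - l) * (- (1 + \<alpha>) / x\<^sup>2 - 1 + 1 / (x - l)\<^sup>2)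
         + (r - l' / (x - l)\<^sup>2)
       = (- r * (2 * l * m + (\<alpha> + s * l - l\<^sup>2)) - l') / (x - l)\<^sup>2"
proof -
  define X where "X = x - l"
  have l: "l = x - X" and X: "X \<noteq> 0" using assms by (auto simp: X_def)
  show ?thesis unfolding l using X assms(1)
    by (simp add: divide_simps) algebra
qed

text \<open>
  The first Hamilton equation is used here, through the value of \<open>l'\<close>; without it a pole of second order at
  \<open>\<lambda>\<close> would remain. The cofactor \<open>l - (x - l) (q + 2 m l)\<close> equals \<open>l\<close> at \<open>x = l\<close>, hence
  it does not vanish identically in \<open>x\<close>.
\<close>

lemma residual_of_phi:
  fixes x l m r s \<alpha> l' m' :: complex
  assumes "x \<noteq> 0" "x \<noteq> l"
  defines "q \<equiv> \<alpha> + s * l - l\<^sup>2"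
  defines "l' \<equiv> - r * (2 * l * m + q)"
  defines "K \<equiv> m * q + m\<^sup>2 * l"
  defines "K' \<equiv> m' * q + m * (r * l + s * l' - 2 * l * l') + (2 * m * m' * l + m\<^sup>2 * l')"
  shows "- (2 * - (r * l * m)) / (x - l) ^ 3
         + ((1 + \<alpha>) / x + s - x - 1 / (x - l)) * (- (r * l * m) / (x - l)\<^sup>2)
         - 2 * (r * l / (x - l)\<^sup>2) * ((m * l / (x - l) - K) / x)
         - - (r * x) / (x - l) * (- (m * l) / (x - l)\<^sup>2 / x - (m * l / (x - l) - K) / x\<^sup>2)
         + ((m' * l + m * l') / (x - l) + m * l * l' / (x - l)\<^sup>2 - K') / x
       = (m' - r * (m\<^sup>2 + (s - 2 * l) * m)) * (l - (x - l) * (q + 2 * m * l)) / (x * (x - l))"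
proof -
  define X where "X = x - l"
  have l: "l = x - X" and X: "X \<noteq> 0" using assms(1,2) by (auto simp: X_def)
  show ?thesis unfolding K'_def K_def l'_def q_def l using X assms(1)
    by (simp add: divide_simps) algebra
qed



section \<open>The Hamiltonian and the compatibility functions\<close>

text \<open>The speed at which the linear coefficient of \<open>\<tau>\<close> moves with \<open>t\<close>.\<close>

definition heun_speed :: complex where
  "heun_speed = of_real (sqrt 2 / 2)"

lemma heun_speed_sq: "heun_speed\<^sup>2 = 1 / 2"
  unfolding heun_speed_def of_real_power [symmetric] by (simp add: power_divide)

text \<open>This is \<open>\<tau>(l) - \<sigma>'(l)\<close>, the coefficient of \<open>\<mu>\<close> in the deformed equation.\<close>

definition heun_drift :: "real \<Rightarrow> real \<Rightarrow> complex \<Rightarrow> complex" where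
  "heun_drift \<alpha> t l = of_real \<alpha> + heun_speed * of_real t * l - l\<^sup>2"

text \<open>
  The quantity \<open>\<mu> (\<tau>(\<lambda>) - \<sigma>'(\<lambda>)) + \<mu>\<^sup>2 \<sigma>(\<lambda>)\<close> subtracted in the deformed equation, times \<open>- r\<close>.
\<close>

definition heun_hamiltonian :: "real \<Rightarrow> complex \<Rightarrow> complex \<Rightarrow> real \<Rightarrow> complex" where
  "heun_hamiltonian \<alpha> l m t = - heun_speed * (l * m\<^sup>2 + heun_drift \<alpha> t l * m)"

lemma poly_heun_sigma [simp]: "poly (heun_sigma t) x = x"
  by (simp add: heun_sigma_def)

lemma poly_pderiv_heun_sigma [simp]: "poly (pderiv (heun_sigma t)) x = 1"
  by (simp add: heun_sigma_def pderiv_pCons)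

lemma poly_heun_tau: "poly (heun_tau \<alpha> t) x = heun_drift \<alpha> t x + 1"
  by (simp add: heun_tau_def heun_drift_def heun_speed_def algebra_simps power2_eq_square)

lemma heun_hamiltonian_derivs:
  "((\<lambda>m. heun_hamiltonian \<alpha> l m t) has_field_derivative
      - heun_speed * (2 * l * m + heun_drift \<alpha> t l)) (at m)"
  "((\<lambda>l. heun_hamiltonian \<alpha> l m t) has_field_derivative
      - heun_speed * (m\<^sup>2 + (heun_speed * of_real t - 2 * l) * m)) (at l)"
  unfolding heun_hamiltonian_def heun_drift_def
  by (auto intro!: derivative_eq_intros simp: algebra_simps)

lemma hamiltonian_system_heun:
  "hamiltonian_system (heun_hamiltonian \<alpha>) T lam \<mu> \<longleftrightarrow>
    (\<forall>t\<in>T.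
      (lam has_vector_derivative - heun_speed * (2 * lam t * \<mu> t + heun_drift \<alpha> t (lam t))) (at t) \<and>
      (\<mu> has_vector_derivative
         heun_speed * ((\<mu> t)\<^sup>2 + (heun_speed * of_real t - 2 * lam t) * \<mu> t)) (at t))"
  unfolding hamiltonian_system_def
  by (simp add: DERIV_imp_deriv[OF heun_hamiltonian_derivs(1)]
        DERIV_imp_deriv[OF heun_hamiltonian_derivs(2)])

text \<open>
  The two explicit forms hold also at \<open>x = l\<close>, where \<open>1 / (x - l)\<close> has the value \<open>0\<close>. They
  can therefore be differentiated in \<open>t\<close> at fixed \<open>x\<close> without restricting \<open>t\<close> to a neighbourhood
  on which \<open>\<lambda>(t) \<noteq> x\<close>.
\<close>

lemma deformed_P_heun:
  assumes "x \<noteq> 0"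
  shows "deformed_P (heun_sigma t) (heun_tau \<alpha> t) l x =
           (1 + of_real \<alpha>) / x + heun_speed * of_real t - x - 1 / (x - l)"
  using assms by (simp add: deformed_P_def poly_heun_tau heun_drift_def diff_divide_distrib
      add_divide_distrib power2_eq_square)

lemma deformed_Q_heun:
  "deformed_Q (heun_sigma t) (heun_tau \<alpha> t) (heun_eta n t) l m x =
     (m * l / (x - l) - (m * heun_drift \<alpha> t l + m\<^sup>2 * l)) / x"
  by (simp add: deformed_Q_def poly_heun_tau heun_eta_def)

text \<open>
  The leading terms \<open>r x\<close> of \<open>a P\<close> and of \<open>\<integral> P_t dx\<close> have to cancel for \<open>b\<close> to stay bounded at
  infinity, which fixes the factor \<open>- r\<close> of \<open>a\<close>. The residue of \<open>b\<close> is then read off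
  from the poles of third order in the second scalar equation.
\<close>

definition heun_a :: "complex \<Rightarrow> complex \<Rightarrow> real \<Rightarrow> complex \<Rightarrow> complex" where
  "heun_a l m t x = - (heun_speed * x) / (x - l)"

definition heun_b :: "complex \<Rightarrow> complex \<Rightarrow> real \<Rightarrow> complex \<Rightarrow> complex" where
  "heun_b l m t x = heun_speed * l * m / (x - l)"


section \<open>Derivatives of the coefficients\<close>

lemma has_field_derivative_double_pole:
  fixes k l x :: complex
  assumes "x \<noteq> l"
  shows "((\<lambda>x. k / (x - l)\<^sup>2) has_field_derivative - (2 * k) / (x - l) ^ 3) (at x)"
proof -
  have "((\<lambda>x. k / (x - l)\<^sup>2) has_field_derivative
      - (k * (2 * (x - l))) / ((x - l)\<^sup>2 * (x - l)\<^sup>2)) (at x)"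
    using assms by (auto intro!: derivative_eq_intros simp: algebra_simps)
  moreover have "- (k * (2 * X)) / (X\<^sup>2 * X\<^sup>2) = - (2 * k) / X ^ 3" if "X \<noteq> 0" for X
    using that by (simp add: divide_simps) algebra
  moreover have "x - l \<noteq> 0"
    using assms by simp
  ultimately show ?thesis
    by (simp only: not_False_eq_True)
qed

lemma heun_a_deriv:
  assumes "x \<noteq> l"
  shows "(heun_a l m t has_field_derivative heun_speed * l / (x - l)\<^sup>2) (at x)"
  unfolding heun_a_def using assms
  by (auto intro!: derivative_eq_intros simp: field_simps power2_eq_square)

lemma heun_b_deriv:
  assumes "x \<noteq> l"
  shows "(heun_b l m t has_field_derivative - (heun_speed * l * m) / (x - l)\<^sup>2) (at x)"
  unfolding heun_b_def using assms
  by (auto intro!: derivative_eq_intros simp: field_simps power2_eq_square)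

lemma deformed_P_deriv:
  assumes "x \<noteq> 0" "x \<noteq> l"
  shows "(deformed_P (heun_sigma t) (heun_tau \<alpha> t) l has_field_derivative
           - (1 + of_real \<alpha>) / x\<^sup>2 - 1 + 1 / (x - l)\<^sup>2) (at x)"
proof -
  have "((\<lambda>x. (1 + of_real \<alpha>) / x + heun_speed * of_real t - x - 1 / (x - l)) has_field_derivative
           - (1 + of_real \<alpha>) / x\<^sup>2 - 1 + 1 / (x - l)\<^sup>2) (at x)"
    using assms by (auto intro!: derivative_eq_intros simp: field_simps power2_eq_square)
  then show ?thesis
    by (rule has_field_derivative_transform_within_open[where S = "- {0}"])
      (use assms in \<open>auto simp: deformed_P_heun\<close>)
qed

lemma deformed_P_time_deriv:
  assumes "x \<noteq> 0" "x \<noteq> lam t" "(lam has_vector_derivative l') (at t)"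
  shows "((\<lambda>s. deformed_P (heun_sigma s) (heun_tau \<alpha> s) (lam s) x) has_vector_derivative
           heun_speed - l' / (x - lam t)\<^sup>2) (at t)"
  using assms(2,3) unfolding deformed_P_heun[OF assms(1)] has_vector_derivative_def
  by (auto intro!: derivative_eq_intros
      simp: fun_eq_iff field_simps power2_eq_square scaleR_conv_of_real)

lemma deformed_Q_deriv:
  assumes "x \<noteq> 0" "x \<noteq> l"
  shows "(deformed_Q (heun_sigma t) (heun_tau \<alpha> t) (heun_eta n t) l m has_field_derivative
           - (m * l) / (x - l)\<^sup>2 / x
           - (m * l / (x - l) - (m * heun_drift \<alpha> t l + m\<^sup>2 * l)) / x\<^sup>2) (at x)"
proof -
  have "((\<lambda>x. (m * l / (x - l) - K) / x) has_field_derivative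
           - (m * l) / (x - l)\<^sup>2 / x - (m * l / (x - l) - K) / x\<^sup>2) (at x)" for K
    using assms by (auto intro!: derivative_eq_intros simp: power2_eq_square)
      (simp add: diff_divide_distrib)
  then show ?thesis
    unfolding deformed_Q_heun .
qed

lemma heun_drift_time_deriv:
  assumes "(lam has_vector_derivative l') (at t)"
  shows "((\<lambda>s. heun_drift \<alpha> s (lam s)) has_vector_derivative
           heun_speed * lam t + heun_speed * of_real t * l' - 2 * lam t * l') (at t)"
  using assms unfolding heun_drift_def has_vector_derivative_def
  by (auto intro!: derivative_eq_intros simp: fun_eq_iff algebra_simps scaleR_conv_of_real)

lemma deformed_Q_time_deriv:
  assumes x: "x \<noteq> 0" "x \<noteq> lam t"
    and l': "(lam has_vector_derivative l') (at t)" and m': "(\<mu> has_vector_derivative m') (at t)"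
  shows "((\<lambda>s. deformed_Q (heun_sigma s) (heun_tau \<alpha> s) (heun_eta n s) (lam s) (\<mu> s) x)
            has_vector_derivative
          ((m' * lam t + \<mu> t * l') / (x - lam t) + \<mu> t * lam t * l' / (x - lam t)\<^sup>2
           - (m' * heun_drift \<alpha> t (lam t)
              + \<mu> t * (heun_speed * lam t + heun_speed * of_real t * l' - 2 * lam t * l')
              + (2 * \<mu> t * m' * lam t + (\<mu> t)\<^sup>2 * l'))) / x) (at t)"
proof -
  have "((\<lambda>s. (\<mu> s * lam s / (x - lam s) - (\<mu> s * q s + (\<mu> s)\<^sup>2 * lam s)) / x)
            has_vector_derivative
          ((m' * lam t + \<mu> t * l') / (x - lam t) + \<mu> t * lam t * l' / (x - lam t)\<^sup>2
           - (m' * q t + \<mu> t * q' + (2 * \<mu> t * m' * lam t + (\<mu> t)\<^sup>2 * l'))) / x) (at t)"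
    if "(q has_vector_derivative q') (at t)" for q q'
    using l' m' that x unfolding has_vector_derivative_def
    by (auto intro!: derivative_eq_intros simp: fun_eq_iff scaleR_conv_of_real power2_eq_square)
      (simp add: divide_simps, algebra)
  from this[OF heun_drift_time_deriv[OF l']] show ?thesis
    unfolding deformed_Q_heun .
qed


section \<open>Compatibility is equivalent to the Hamiltonian system\<close>

text \<open>
  At a single point \<open>x\<close> the second scalar equation may hold because the cofactor of the second Hamilton
  equation vanishes there; only the first Hamilton equation follows from one point.
\<close>

lemma heun_compatible_at_iff:
  fixes \<alpha> t :: real and n :: nat
  assumes x: "x \<noteq> 0" "x \<noteq> lam t"
    and l': "(lam has_vector_derivative l') (at t)" and m': "(\<mu> has_vector_derivative m') (at t)"
  defines "P \<equiv> \<lambda>x t. deformed_P (heun_sigma t) (heun_tau \<alpha> t) (lam t) x"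
  defines "Q \<equiv> \<lambda>x t. deformed_Q (heun_sigma t) (heun_tau \<alpha> t) (heun_eta n t) (lam t) (\<mu> t) x"
  defines "a \<equiv> \<lambda>x t. heun_a (lam t) (\<mu> t) t x"
  defines "b \<equiv> \<lambda>x t. heun_b (lam t) (\<mu> t) t x"
  shows "(let (f, g) = total_dx P Q (total_dx P Q (b, a));
              (f', g') = total_dt P Q a b (\<lambda>x t. - Q x t, \<lambda>x t. - P x t)
          in f x t = f' x t \<and> g x t = g' x t) \<longleftrightarrow>
         l' = - heun_speed * (2 * lam t * \<mu> t + heun_drift \<alpha> t (lam t)) \<and>
         (m' - heun_speed * ((\<mu> t)\<^sup>2 + (heun_speed * of_real t - 2 * lam t) * \<mu> t))
           * (lam t - (x - lam t) * (heun_drift \<alpha> t (lam t) + 2 * \<mu> t * lam t)) = 0"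
    (is "?lhs \<longleftrightarrow> l' = ?l' \<and> ?r = 0")
proof -
  have l: "x \<in> - {lam t}" "open (- {lam t})"
    using x by auto
  have a: "((\<lambda>y. a y t) has_field_derivative heun_speed * lam t / (y - lam t)\<^sup>2) (at y)"
    and b: "((\<lambda>y. b y t) has_field_derivative - (heun_speed * lam t * \<mu> t) / (y - lam t)\<^sup>2) (at y)"
    if "y \<in> - {lam t}" for y
    using heun_a_deriv[of y "lam t" "\<mu> t" t] heun_b_deriv[of y "lam t" "\<mu> t" t] that
    unfolding a_def b_def by simp_all
  have fold_x: "deformed_P (heun_sigma t) (heun_tau \<alpha> t) (lam t) = (\<lambda>y. P y t)"
      "deformed_Q (heun_sigma t) (heun_tau \<alpha> t) (heun_eta n t) (lam t) (\<mu> t) = (\<lambda>y. Q y t)"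
    and fold_t: "(\<lambda>s. deformed_P (heun_sigma s) (heun_tau \<alpha> s) (lam s) x) = P x"
      "(\<lambda>s. deformed_Q (heun_sigma s) (heun_tau \<alpha> s) (heun_eta n s) (lam s) (\<mu> s) x) = Q x"
    by (simp_all add: P_def Q_def)
  note P = deformed_P_deriv[OF x, of t \<alpha>, unfolded fold_x]
    deformed_P_time_deriv[where lam = lam, OF x l', of \<alpha>, unfolded fold_t]
  note Q = deformed_Q_deriv[OF x, of t \<alpha> n "\<mu> t", unfolded fold_x]
    deformed_Q_time_deriv[where lam = lam, OF x l' m', of \<alpha> n, unfolded fold_t]
  have "?lhs \<longleftrightarrow> (?l' - l') / (x - lam t)\<^sup>2 = 0 \<and>
     - (2 * - (heun_speed * lam t * \<mu> t)) / (x - lam t) ^ 3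
         + P x t * (- (heun_speed * lam t * \<mu> t) / (x - lam t)\<^sup>2)
         - 2 * (heun_speed * lam t / (x - lam t)\<^sup>2) * Q x t
         - a x t * (- (\<mu> t * lam t) / (x - lam t)\<^sup>2 / x
             - (\<mu> t * lam t / (x - lam t) - (\<mu> t * heun_drift \<alpha> t (lam t) + (\<mu> t)\<^sup>2 * lam t)) / x\<^sup>2)
         + ((m' * lam t + \<mu> t * l') / (x - lam t) + \<mu> t * lam t * l' / (x - lam t)\<^sup>2
             - (m' * heun_drift \<alpha> t (lam t)
               + \<mu> t * (heun_speed * lam t + heun_speed * of_real t * l' - 2 * lam t * l')
               + (2 * \<mu> t * m' * lam t + (\<mu> t)\<^sup>2 * l'))) / x = 0" (is "_ \<longleftrightarrow> _ \<and> ?residual_of_phi = 0")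
    by (rule trans[OF total_derivatives_agree_iff[where a = a and b = b and P = P and Q = Q, OF l(2,1) a
        has_field_derivative_double_pole[OF x(2)] b has_field_derivative_double_pole[OF x(2)] P Q]],
        assumption, assumption)
      (simp only: P_def a_def deformed_P_heun[OF x(1)] heun_a_def heun_drift_def
        residual_of_phi_x[OF x])
  also have "\<dots> \<longleftrightarrow> l' = ?l' \<and> ?residual_of_phi = 0"
    using x by auto
  also have "\<dots> \<longleftrightarrow> l' = ?l' \<and> ?r / (x * (x - lam t)) = 0"
  proof (rule conj_cong[OF refl])
    assume "l' = ?l'"
    then show "?residual_of_phi = 0 \<longleftrightarrow> ?r / (x * (x - lam t)) = 0"
      unfolding a_def P_def Q_def heun_a_def deformed_P_heun[OF x(1)] deformed_Q_heun heun_drift_def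
      using residual_of_phi[OF x, of heun_speed "\<mu> t" "of_real \<alpha>" "heun_speed * of_real t" m']
      by simp
  qed
  also have "\<dots> \<longleftrightarrow> l' = ?l' \<and> ?r = 0"
    using x by simp
  finally show ?thesis .
qed


text \<open>
  Two points \<open>x\<close> suffice to get rid of the cofactor \<open>\<lambda> - (x - \<lambda>) w\<close>, \<open>w = q + 2 \<mu> \<lambda>\<close>: at \<open>2 \<lambda>\<close>
  and \<open>3 \<lambda>\<close> it is \<open>\<lambda> (1 - w)\<close> and \<open>\<lambda> (1 - 2 w)\<close>, which are not both zero. Both points differ from
  \<open>0\<close> and \<open>\<lambda>\<close> because \<open>\<lambda> \<noteq> 0\<close>.
\<close>

lemma heun_hamiltonian_isomonodromic:
  "isomonodromic_hamiltonian heun_sigma (heun_tau \<alpha>) (heun_eta n) (heun_hamiltonian \<alpha>)"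
  unfolding isomonodromic_hamiltonian_def
proof (rule conjI; (rule exI[of _ heun_a], rule exI[of _ heun_b])?; intro conjI allI impI)
  fix t :: real and l m :: complex
  show "(\<lambda>l. heun_hamiltonian \<alpha> l m t) field_differentiable at l"
    and "(\<lambda>m. heun_hamiltonian \<alpha> l m t) field_differentiable at m"
    using heun_hamiltonian_derivs unfolding field_differentiable_def by blast+
  show "rational_off (heun_sigma t) l (heun_a l m t)"
    unfolding rational_off_def heun_a_def
    by (intro exI[of _ "[:0, - heun_speed:]"] exI[of _ "[:- l, 1:]"]) (simp add: algebra_simps)
  show "rational_off (heun_sigma t) l (heun_b l m t)"
    unfolding rational_off_def heun_b_def
    by (intro exI[of _ "[:heun_speed * l * m:]"] exI[of _ "[:- l, 1:]"]) (simp add: algebra_simps)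
next
  fix T and lam \<mu> :: "real \<Rightarrow> complex"
  assume "admissible heun_sigma T lam"
    and diff: "\<forall>t\<in>T. lam differentiable (at t) \<and> \<mu> differentiable (at t)"
  then have lam0: "lam t \<noteq> 0" if "t \<in> T" for t
    using that by (simp add: admissible_def)
  let ?X = "\<lambda>t. {x. poly (heun_sigma t) x \<noteq> 0 \<and> x \<noteq> lam t}"
  let ?P = "\<lambda>x t. deformed_P (heun_sigma t) (heun_tau \<alpha> t) (lam t) x"
  let ?Q = "\<lambda>x t. deformed_Q (heun_sigma t) (heun_tau \<alpha> t) (heun_eta n t) (lam t) (\<mu> t) x"
  let ?a = "\<lambda>x t. heun_a (lam t) (\<mu> t) t x" and ?b = "\<lambda>x t. heun_b (lam t) (\<mu> t) t x"
  let ?C = "\<lambda>t x. let (f, g) = total_dx ?P ?Q (total_dx ?P ?Q (?b, ?a));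
                 (f', g') = total_dt ?P ?Q ?a ?b (\<lambda>x t. - ?Q x t, \<lambda>x t. - ?P x t)
             in f x t = f' x t \<and> g x t = g' x t"
  let ?l' = "\<lambda>t. - heun_speed * (2 * lam t * \<mu> t + heun_drift \<alpha> t (lam t))"
  let ?m' = "\<lambda>t. heun_speed * ((\<mu> t)\<^sup>2 + (heun_speed * of_real t - 2 * lam t) * \<mu> t)"
  let ?w = "\<lambda>t. heun_drift \<alpha> t (lam t) + 2 * \<mu> t * lam t"
  have deriv: "\<exists>l' m'. (lam has_vector_derivative l') (at t) \<and> (\<mu> has_vector_derivative m') (at t)"
    if "t \<in> T" for t
    using diff that by (metis vector_derivative_works)
  show "compatible T ?X ?P ?Q ?a ?b \<longleftrightarrow> hamiltonian_system (heun_hamiltonian \<alpha>) T lam \<mu>"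
    unfolding hamiltonian_system_heun
  proof (intro iffI ballI)
    fix t assume comp: "compatible T ?X ?P ?Q ?a ?b" and t: "t \<in> T"
    obtain l' m' where l': "(lam has_vector_derivative l') (at t)"
      and m': "(\<mu> has_vector_derivative m') (at t)"
      using deriv[OF t] by blast
    have eqs: "l' = ?l' t \<and> (m' - ?m' t) * (lam t - (x - lam t) * ?w t) = 0"
      if x: "x \<noteq> 0" "x \<noteq> lam t" for x
    proof -
      have "?C t x"
        using comp t x unfolding compatible_def poly_heun_sigma by blast
      then show ?thesis
        by (rule heun_compatible_at_iff[where lam = lam, OF x l' m', THEN iffD1])
    qed
    have "l' = ?l' t" "(m' - ?m' t) * (lam t - lam t * ?w t) = 0"
      using eqs[of "2 * lam t"] lam0[OF t] by auto
    moreover have "(m' - ?m' t) * (lam t - 2 * lam t * ?w t) = 0"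
      using eqs[of "3 * lam t"] lam0[OF t] by auto
    \<comment> \<open>Twice the first cofactor minus the second is \<open>\<lambda>\<close>.\<close>
    ultimately have "l' = ?l' t" "(m' - ?m' t) * lam t = 0"
      by (simp, algebra)
    with lam0[OF t] have "l' = ?l' t" "m' = ?m' t"
      by auto
    with l' m' show "(lam has_vector_derivative ?l' t) (at t) \<and> (\<mu> has_vector_derivative ?m' t) (at t)"
      by simp
  next
    assume ham: "\<forall>t\<in>T. (lam has_vector_derivative ?l' t) (at t) \<and> (\<mu> has_vector_derivative ?m' t) (at t)"
    have hol: "f holomorphic_on ?X t"
      if "\<And>x. x \<noteq> 0 \<Longrightarrow> x \<noteq> lam t \<Longrightarrow> (f has_field_derivative f' x) (at x)" for f f' t
      unfolding holomorphic_on_def field_differentiable_def poly_heun_sigma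
      by (blast intro: has_field_derivative_at_within that)
    have "(\<lambda>x. f x t) holomorphic_on ?X t" if "f \<in> {?P, ?Q, ?a, ?b}" for t f
    proof -
      from that consider "f = ?P" | "f = ?Q" | "f = ?a" | "f = ?b" by blast
      then show ?thesis
      proof cases
        case 1 then show ?thesis using hol[OF deformed_P_deriv] by simp
      next
        case 2 then show ?thesis using hol[OF deformed_Q_deriv] by simp
      next
        case 3 then show ?thesis using hol[OF heun_a_deriv] by simp
      next
        case 4 then show ?thesis using hol[OF heun_b_deriv] by simp
      qed
    qed
    moreover have "(\<lambda>s. ?P x s) differentiable (at t) \<and> (\<lambda>s. ?Q x s) differentiable (at t)"
      if "t \<in> T" "x \<in> ?X t" for t x
      using deformed_P_time_deriv deformed_Q_time_deriv deriv[OF that(1)] that(2)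
      by (simp, blast intro: differentiableI_vector)
    moreover have "?C t x"
      if "t \<in> T" "x \<in> ?X t" for t x
      using that ham by (subst heun_compatible_at_iff[where lam = lam]) auto
    ultimately show "compatible T ?X ?P ?Q ?a ?b"
      unfolding compatible_def by blast
  qed
qed


section \<open>Elimination of \<open>\<mu>\<close>\<close>

text \<open>
  The right-hand side is \<open>4 dv/dt\<close> along the Hamiltonian flow, for \<open>v = 2 l m + q\<close>; the left-hand side is
  that of Painlev\'e IV at \<open>z = t / 2\<close>, \<open>y = - 2 r l\<close>, \<open>dy/dz = 2 v\<close>. Because \<open>r\<^sup>2 = 1 / 2\<close>, both sides are
  odd in \<open>r\<close> when written in terms of \<open>s = r t\<close> in place of \<open>t\<close>, so that \<open>r\<close> can be factored out. The
  two terms with a pole at \<open>l = 0\<close> combine to \<open>2 (\<alpha>\<^sup>2 - v\<^sup>2) / l\<close>, which is a polynomial as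
  \<open>v - \<alpha>\<close> is divisible by \<open>l\<close>.
\<close>

lemma painleve_IV_rhs:
  fixes r l m t \<alpha> :: complex
  assumes r: "r\<^sup>2 = 1 / 2" and l: "l \<noteq> 0"
  defines "q \<equiv> \<alpha> + r * t * l - l\<^sup>2"
  defines "l' \<equiv> - r * (2 * l * m + q)"
  defines "y \<equiv> - 2 * r * l"
  shows "1 / (2 * y) * (2 * (2 * l * m + q))\<^sup>2 + 3 / 2 * y ^ 3 + 4 * (t / 2) * y\<^sup>2
           + 2 * ((t / 2)\<^sup>2 - (\<alpha> + 1)) * y + (- 2 * \<alpha>\<^sup>2) / y
         = 4 * (2 * l' * m + 2 * l * (r * (m\<^sup>2 + (r * t - 2 * l) * m))
             + (r * l + r * t * l' - 2 * l * l'))"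
proof -
  define s v where "s = r * t" and "v = 2 * l * m + q"
  have rr: "r * (r * z) = z / 2" for z
    using arg_cong[OF r, of "\<lambda>w. w * z"] by (simp add: power2_eq_square mult.assoc)
  have t: "t = 2 * r * s"
    unfolding s_def mult.assoc rr by simp
  have q: "q = \<alpha> + s * l - l\<^sup>2"
    by (simp add: q_def s_def)
  have l': "l' = - r * v"
    by (simp add: l'_def v_def)
  have r0: "r \<noteq> 0"
    using r by auto
  have inv_y: "z / y = - r * z / l" for z
    using l r0 rr[of "z"] by (simp add: y_def field_simps)
  have y2: "y\<^sup>2 = 2 * l\<^sup>2" and y3: "y ^ 3 = - 4 * r * l ^ 3" and t2: "(t / 2)\<^sup>2 = s\<^sup>2 / 2"
    by (simp_all add: y_def t power2_eq_square power3_eq_cube rr mult_ac)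
  have "1 / (2 * y) * (2 * v)\<^sup>2 + 3 / 2 * y ^ 3 + 4 * (t / 2) * y\<^sup>2
           + 2 * ((t / 2)\<^sup>2 - (\<alpha> + 1)) * y + (- 2 * \<alpha>\<^sup>2) / y
      = 2 * (v\<^sup>2 / y) + 3 / 2 * y ^ 3 + 2 * t * y\<^sup>2
           + 2 * ((t / 2)\<^sup>2 - (\<alpha> + 1)) * y - 2 * (\<alpha>\<^sup>2 / y)"
    by (simp add: power_mult_distrib)
  also have "\<dots> = r * (2 * (\<alpha>\<^sup>2 - v\<^sup>2) / l - 6 * l ^ 3 + 8 * s * l\<^sup>2 - 2 * (s\<^sup>2 - 2 * (\<alpha> + 1)) * l)"
    unfolding inv_y y2 y3 t2 unfolding t y_def using l by (simp add: field_simps)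
  also have "2 * (\<alpha>\<^sup>2 - v\<^sup>2) / l = 2 * (2 * \<alpha> + s * l - l\<^sup>2 + 2 * l * m) * (l - s - 2 * m)"
    using l unfolding v_def q by (simp add: divide_simps) algebra
  also have "r * (2 * (2 * \<alpha> + s * l - l\<^sup>2 + 2 * l * m) * (l - s - 2 * m)
               - 6 * l ^ 3 + 8 * s * l\<^sup>2 - 2 * (s\<^sup>2 - 2 * (\<alpha> + 1)) * l)
      = 4 * (2 * l' * m + 2 * l * (r * (m\<^sup>2 + (s - 2 * l) * m)) + (r * l + s * l' - 2 * l * l'))"
    unfolding l' v_def q by algebra
  finally show ?thesis
    by (simp only: v_def s_def)
qed

lemma has_vector_derivative_rescale:
  fixes f :: "real \<Rightarrow> complex"
  assumes "(f has_vector_derivative d) (at (c * t))"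
  shows "((\<lambda>s. k * f (c * s)) has_vector_derivative k * of_real c * d) (at t)"
proof -
  have "((\<lambda>s. c * s) has_vector_derivative c) (at t)"
    by (auto intro!: derivative_eq_intros)
  from vector_diff_chain_at[OF this assms]
  have "((\<lambda>s. f (c * s)) has_vector_derivative c *\<^sub>R d) (at t)"
    by (simp add: o_def)
  then show ?thesis
    by (auto intro!: derivative_eq_intros simp: scaleR_conv_of_real)
qed

lemma has_vector_derivative_quotient:
  fixes f g :: "real \<Rightarrow> complex"
  assumes f: "(f has_vector_derivative f') (at t)" and g: "(g has_vector_derivative g') (at t)"
    and nz: "g t \<noteq> 0"
  shows "((\<lambda>s. f s / g s) has_vector_derivative (f' - f t / g t * g') / g t) (at t)"
proof -
  have "((\<lambda>s. f s / g s) has_derivative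
          (\<lambda>h. (h *\<^sub>R f' * g t - f t * (h *\<^sub>R g')) / (g t * g t))) (at t)"
    using f g nz unfolding has_vector_derivative_def by (rule has_derivative_divide')
  moreover have "(h *\<^sub>R f' * g t - f t * (h *\<^sub>R g')) / (g t * g t)
      = h *\<^sub>R ((f' - f t / g t * g') / g t)" for h
    using nz by (simp add: scaleR_conv_of_real diff_divide_distrib right_diff_distrib)
  ultimately show ?thesis
    by (simp only: has_vector_derivative_def)
qed

text \<open>
  This is \<open>- \<lambda>' / r\<close> along the Hamiltonian flow; it replaces \<open>\<mu>\<close> as the second coordinate.
\<close>

definition heun_flow_rate :: "real \<Rightarrow> real \<Rightarrow> complex \<Rightarrow> complex \<Rightarrow> complex" where
  "heun_flow_rate \<alpha> t l m = 2 * l * m + heun_drift \<alpha> t l"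

lemma heun_flow_rate_time_deriv:
  assumes "(lam has_vector_derivative l') (at t)" "(\<mu> has_vector_derivative m') (at t)"
  shows "((\<lambda>s. heun_flow_rate \<alpha> s (lam s) (\<mu> s)) has_vector_derivative
           2 * l' * \<mu> t + 2 * lam t * m'
           + (heun_speed * lam t + heun_speed * of_real t * l' - 2 * lam t * l')) (at t)"
  unfolding heun_flow_rate_def by (auto intro!: derivative_eq_intros heun_drift_time_deriv assms)

text \<open>The time derivative of \<open>heun_flow_rate\<close> along the flow, both Hamilton equations being inserted.\<close>

definition heun_flow_rate_dot :: "real \<Rightarrow> real \<Rightarrow> complex \<Rightarrow> complex \<Rightarrow> complex" where
  "heun_flow_rate_dot \<alpha> t l m =
     2 * (- heun_speed * heun_flow_rate \<alpha> t l m) * m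
     + 2 * l * (heun_speed * (m\<^sup>2 + (heun_speed * of_real t - 2 * l) * m))
     + (heun_speed * l + heun_speed * of_real t * (- heun_speed * heun_flow_rate \<alpha> t l m)
          - 2 * l * (- heun_speed * heun_flow_rate \<alpha> t l m))"

lemma painleve_IV_rhs_heun:
  assumes "lam t \<noteq> 0"
  defines "y \<equiv> - 2 * heun_speed * lam t"
  shows "1 / (2 * y) * (2 * heun_flow_rate \<alpha> t (lam t) m)\<^sup>2 + 3 / 2 * y ^ 3 + 4 * of_real (t / 2) * y\<^sup>2
           + 2 * ((of_real (t / 2))\<^sup>2 - (of_real \<alpha> + 1)) * y + (- 2 * (of_real \<alpha>)\<^sup>2) / y
         = 4 * heun_flow_rate_dot \<alpha> t (lam t) m"
  unfolding y_def heun_flow_rate_def heun_flow_rate_dot_def heun_drift_def of_real_divide of_real_numeral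
  by (rule painleve_IV_rhs[OF heun_speed_sq assms(1)])

lemma two_heun_speed_sq: "2 * (heun_speed * (heun_speed * V)) = V"
proof -
  have "2 * (heun_speed * (heun_speed * V)) = 2 * heun_speed\<^sup>2 * V"
    by (simp only: power2_eq_square mult.assoc)
  then show ?thesis
    by (simp only: heun_speed_sq) simp
qed

lemma hamiltonian_system_imp_painleve_IV:
  assumes lam0: "\<And>t. t \<in> T \<Longrightarrow> lam t \<noteq> 0"
    and ham: "hamiltonian_system (heun_hamiltonian \<alpha>) T lam \<mu>"
  shows "painleve_IV (of_real \<alpha> + 1) (- 2 * (of_real \<alpha>)\<^sup>2) ((\<lambda>t. 1 / 2 * t) ` T)
           (\<lambda>z. - 2 * heun_speed * lam (z / (1 / 2)))"
proof -
  let ?v = "\<lambda>t. heun_flow_rate \<alpha> t (lam t) (\<mu> t)" and ?v' = "\<lambda>t. heun_flow_rate_dot \<alpha> t (lam t) (\<mu> t)"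
  have lam': "(lam has_vector_derivative - heun_speed * ?v t) (at t)"
    and \<mu>': "(\<mu> has_vector_derivative
      heun_speed * ((\<mu> t)\<^sup>2 + (heun_speed * of_real t - 2 * lam t) * \<mu> t)) (at t)" if "t \<in> T" for t
    using ham that unfolding hamiltonian_system_heun heun_flow_rate_def by auto
  have v': "(?v has_vector_derivative ?v' t) (at t)" if "t \<in> T" for t
    unfolding heun_flow_rate_dot_def by (rule heun_flow_rate_time_deriv[OF lam'[OF that] \<mu>'[OF that]])
  show ?thesis
    unfolding painleve_IV_def
  proof (rule exI[of _ "\<lambda>z. 2 * ?v (2 * z)"], rule exI[of _ "\<lambda>z. 4 * ?v' (2 * z)"],
      intro ballI)
    fix z assume "z \<in> (\<lambda>t. 1 / 2 * t) ` T"
    then have T: "2 * z \<in> T" by auto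
    have y: "z / (1 / 2) = 2 * z" for z :: real
      by simp
    have "((\<lambda>z. - 2 * heun_speed * lam (2 * z)) has_vector_derivative
             - 2 * heun_speed * of_real 2 * (- heun_speed * ?v (2 * z))) (at z)"
      by (rule has_vector_derivative_rescale) (rule lam'[OF T])
    moreover have "- 2 * heun_speed * of_real 2 * (- heun_speed * V) = 2 * V" for V
      using two_heun_speed_sq[of "2 * V"] by simp
    ultimately have "((\<lambda>z. - 2 * heun_speed * lam (2 * z)) has_vector_derivative 2 * ?v (2 * z)) (at z)"
      by (simp only:)
    moreover have "((\<lambda>z. 2 * ?v (2 * z)) has_vector_derivative 2 * of_real 2 * ?v' (2 * z)) (at z)"
      by (rule has_vector_derivative_rescale) (rule v'[OF T])
    moreover have "- 2 * heun_speed * lam (2 * z) \<noteq> 0"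
      using lam0[OF T] heun_speed_sq by auto
    moreover note painleve_IV_rhs_heun[where lam = lam, OF lam0[OF T], of \<alpha> "\<mu> (2 * z)", symmetric]
    ultimately show "- 2 * heun_speed * lam (z / (1 / 2)) \<noteq> 0 \<and>
        ((\<lambda>z. - 2 * heun_speed * lam (z / (1 / 2))) has_vector_derivative 2 * ?v (2 * z)) (at z) \<and>
        ((\<lambda>z. 2 * ?v (2 * z)) has_vector_derivative 4 * ?v' (2 * z)) (at z) \<and>
        4 * ?v' (2 * z) =
          1 / (2 * (- 2 * heun_speed * lam (z / (1 / 2)))) * (2 * ?v (2 * z))\<^sup>2
          + 3 / 2 * (- 2 * heun_speed * lam (z / (1 / 2))) ^ 3
          + 4 * of_real z * (- 2 * heun_speed * lam (z / (1 / 2)))\<^sup>2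
          + 2 * ((of_real z)\<^sup>2 - (of_real \<alpha> + 1)) * (- 2 * heun_speed * lam (z / (1 / 2)))
          + - 2 * (of_real \<alpha>)\<^sup>2 / (- 2 * heun_speed * lam (z / (1 / 2)))"
      unfolding y by simp
  qed
qed

text \<open>
  The candidate for \<open>\<mu>\<close> is the solution of \<open>dy/dz = 2 (2 \<lambda> \<mu> + q)\<close>. The first Hamilton equation then
  holds by construction. The derivative of \<open>\<mu>\<close> as a quotient involves \<open>d\<^sup>2y/dz\<^sup>2\<close>, for which
  Painlev\'e IV gives \<open>4 dv/dt\<close> as computed with the second Hamilton equation; solving for \<open>\<mu>'\<close>
  returns that equation.
\<close>

lemma painleve_IV_imp_hamiltonian_system:
  assumes lam0: "\<And>t. t \<in> T \<Longrightarrow> lam t \<noteq> 0"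
    and piv: "painleve_IV (of_real \<alpha> + 1) (- 2 * (of_real \<alpha>)\<^sup>2) ((\<lambda>t. 1 / 2 * t) ` T)
           (\<lambda>z. - 2 * heun_speed * lam (z / (1 / 2)))"
  shows "\<exists>\<mu>. hamiltonian_system (heun_hamiltonian \<alpha>) T lam \<mu>"
proof -
  let ?y = "\<lambda>z. - 2 * heun_speed * lam (z / (1 / 2))"
  obtain y' y'' where piv': "\<And>t. t \<in> T \<Longrightarrow>
      (?y has_vector_derivative y' (1 / 2 * t)) (at (1 / 2 * t)) \<and>
      (y' has_vector_derivative y'' (1 / 2 * t)) (at (1 / 2 * t)) \<and>
      y'' (1 / 2 * t) = 1 / (2 * ?y (1 / 2 * t)) * (y' (1 / 2 * t))\<^sup>2 + 3 / 2 * (?y (1 / 2 * t)) ^ 3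
         + 4 * of_real (1 / 2 * t) * (?y (1 / 2 * t))\<^sup>2
         + 2 * ((of_real (1 / 2 * t))\<^sup>2 - (of_real \<alpha> + 1)) * ?y (1 / 2 * t)
         + (- 2 * (of_real \<alpha>)\<^sup>2) / ?y (1 / 2 * t)"
    using piv unfolding painleve_IV_def by blast
  have half: "1 / 2 * t = t / 2" "t / 2 / (1 / 2) = t" for t :: real
    by simp_all
  note piv' = piv'[unfolded half]
  define \<mu> where "\<mu> t = (1 / 2 * y' (1 / 2 * t) - heun_drift \<alpha> t (lam t)) / (2 * lam t)" for t
  let ?v = "\<lambda>t. heun_flow_rate \<alpha> t (lam t) (\<mu> t)" and ?v' = "\<lambda>t. heun_flow_rate_dot \<alpha> t (lam t) (\<mu> t)"
  have v: "y' (t / 2) = 2 * ?v t" if "t \<in> T" for t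
    using lam0[OF that] by (simp add: \<mu>_def heun_flow_rate_def)
  have lam': "(lam has_vector_derivative - heun_speed * ?v t) (at t)" if "t \<in> T" for t
  proof -
    have "((\<lambda>s. - heun_speed * ?y (1 / 2 * s)) has_vector_derivative
            - heun_speed * of_real (1 / 2) * y' (t / 2)) (at t)"
      by (rule has_vector_derivative_rescale) (unfold half, use piv'[OF that] in blast)
    moreover have "- heun_speed * ?y (1 / 2 * s) = 2 * (heun_speed * (heun_speed * lam s))" for s
      unfolding half by simp
    moreover have "- heun_speed * of_real (1 / 2) * y' (t / 2) = - heun_speed * ?v t"
      by (simp add: v[OF that])
    ultimately show ?thesis
      by (simp only: two_heun_speed_sq)
  qed
  have "(\<mu> has_vector_derivative heun_speed * ((\<mu> t)\<^sup>2 + (heun_speed * of_real t - 2 * lam t) * \<mu> t)) (at t)"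
    if t: "t \<in> T" for t
  proof -
    let ?q' = "heun_speed * lam t + heun_speed * of_real t * (- heun_speed * ?v t)
                 - 2 * lam t * (- heun_speed * ?v t)"
    have y'': "y'' (t / 2) = 4 * ?v' t"
      using piv'[OF t] painleve_IV_rhs_heun[where lam = lam, OF lam0[OF t]] unfolding v[OF t] by simp
    have "((\<lambda>s. 1 / 2 * y' (1 / 2 * s)) has_vector_derivative
            1 / 2 * of_real (1 / 2) * y'' (t / 2)) (at t)"
      by (rule has_vector_derivative_rescale) (unfold half, use piv'[OF t] in blast)
    then have "((\<lambda>s. 1 / 2 * y' (1 / 2 * s) - heun_drift \<alpha> s (lam s)) has_vector_derivative
            1 / 2 * of_real (1 / 2) * y'' (t / 2) - ?q') (at t)"
      by (intro has_vector_derivative_diff heun_drift_time_deriv lam' t)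
    moreover have "((\<lambda>s. 2 * lam s) has_vector_derivative 2 * (- heun_speed * ?v t)) (at t)"
      by (intro has_vector_derivative_mult_right lam' t)
    ultimately have "(\<mu> has_vector_derivative
        (1 / 2 * of_real (1 / 2) * y'' (t / 2) - ?q' - \<mu> t * (2 * (- heun_speed * ?v t))) / (2 * lam t)) (at t)"
      unfolding \<mu>_def[abs_def] by (rule has_vector_derivative_quotient) (use lam0[OF t] in simp)
    moreover have "1 / 2 * of_real (1 / 2) * y'' (t / 2) = ?v' t"
      by (simp add: y'')
    moreover have "(2 * L * m + 2 * l * M + q - q - m * (2 * L)) / (2 * l) = M" if "l \<noteq> 0"
      for L l m M q :: complex
      using that by simp
    ultimately show ?thesis
      using lam0[OF t] by (simp only: heun_flow_rate_dot_def not_False_eq_True)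
  qed
  with lam' show ?thesis
    unfolding hamiltonian_system_heun heun_flow_rate_def by blast
qed


section \<open>The transformation into Painlev\'e IV\<close>

theorem theorem4p2:
  fixes \<alpha> :: real and n :: nat
  assumes "\<alpha> > 0" and "n \<ge> 1"
  shows "(\<forall>t>0. \<forall>u. \<forall>x. x \<noteq> 0 \<longrightarrow>
            (biconfluent_heun \<alpha> n t u x \<longleftrightarrow>
             poly (heun_sigma t) x * deriv (deriv u) x + poly (heun_tau \<alpha> t) x * deriv u x
               + poly (heun_eta n t) x * u x = 0))
         \<and> transforms_to_painleve_IV heun_sigma (heun_tau \<alpha>) (heun_eta n)"
proof (intro conjI allI impI)
  fix t :: real and u :: "complex \<Rightarrow> complex" and x :: complex
  assume x: "x \<noteq> 0"
  let ?e = "of_real (sqrt 6 * real n powr (3 / 2)) :: complex"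
  let ?s = "of_real (sqrt 2 * t / 2) :: complex"
  have "poly (heun_sigma t) x * deriv (deriv u) x + poly (heun_tau \<alpha> t) x * deriv u x
            + poly (heun_eta n t) x * u x
        = x * (deriv (deriv u) x + ((1 + of_real \<alpha>) / x + ?s - x) * deriv u x + ?e / (9 * x) * u x)"
    using x by (simp add: heun_sigma_def heun_tau_def heun_eta_def field_simps)
  with x show "biconfluent_heun \<alpha> n t u x \<longleftrightarrow>
          poly (heun_sigma t) x * deriv (deriv u) x + poly (heun_tau \<alpha> t) x * deriv u x
            + poly (heun_eta n t) x * u x = 0"
    unfolding biconfluent_heun_def by (simp only: mult_eq_0_iff) simp
next
  show "transforms_to_painleve_IV heun_sigma (heun_tau \<alpha>) (heun_eta n)"
    unfolding transforms_to_painleve_IV_def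
  proof (intro exI conjI allI impI)
    show "isomonodromic_hamiltonian heun_sigma (heun_tau \<alpha>) (heun_eta n) (heun_hamiltonian \<alpha>)"
      by (rule heun_hamiltonian_isomonodromic)
    show "- 2 * heun_speed \<noteq> 0"
      using heun_speed_sq by auto
    show "1 / 2 \<noteq> (0 :: real)"
      by simp
    fix T lam assume "admissible heun_sigma T lam"
    then show "(\<exists>\<mu>. hamiltonian_system (heun_hamiltonian \<alpha>) T lam \<mu>) \<longleftrightarrow>
         painleve_IV (of_real \<alpha> + 1) (- 2 * (of_real \<alpha>)\<^sup>2) ((\<lambda>t. 1 / 2 * t) ` T)
           (\<lambda>z. - 2 * heun_speed * lam (z / (1 / 2)))"
      using hamiltonian_system_imp_painleve_IV painleve_IV_imp_hamiltonian_system
      by (auto simp: admissible_def)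
  qed
qed

end
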